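(* Let $0<\mu\le 1$, $h>0$, let $n\ge 1$ be an integer, and put $J=\{0,1,\dots,n\}$. Let $p,q,r:J\to\mathbb{R}$ with $p(t)>0$ and $r(t)>0$ for all $t\in J$. Then all eigenvalues $\lambda\in\mathbb{C}$ of the discrete fractional Sturm-Liouville equation $$\Delta_-^{\mu}\big(p(t)\Delta_+^{\mu}x(t)\big)+q(t)x(t)=\lambda r(t)x(t),\qquad t\in J,$$ are real.
   Context: An eigenvalue is a $\lambda\in\mathbb{C}$ for which the equation has a solution $x:J\to\mathbb{C}$ that is not identically zero. The (Grünwald-Letnikov) delta left and right fractional differences of order $\mu$ of a function $x:J\to\mathbb{C}$ are, for $t\in J$, $$\Delta_-^{\mu}x(t)=\frac{1}{h^{\mu}}\sum_{s=0}^{t}(-1)^s\frac{\mu(\mu-1)\cdots(\mu-s+1)}{s!}x(t-s),$$ $$\Delta_+^{\mu}x(t)=\frac{1}{h^{\mu}}\sum_{s=0}^{n-t}(-1)^s\frac{\mu(\mu-1)\cdots(\mu-s+1)}{s!}x(t+s),$$ where the coefficient for $s=0$ is $1$. The expression $\Delta_-^{\mu}(p(t)\Delta_+^{\mu}x(t))$ means $\Delta_-^\mu$ applied to the function $t\mapsto p(t)\cdot(\Delta_+^\mu x)(t)$ on $J$. *)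

theory Defs
  imports Complex_Main
begin

text \<open>
  A function on \<open>J = {0, \<dots>, n}\<close> is represented by a total function on \<^typ>\<open>nat\<close>.
  For \<open>t \<le> n\<close> the definitions below only use its values at points of \<open>J\<close>.
  The coefficient \<open>\<mu> (\<mu> - 1) \<cdots> (\<mu> - s + 1) / s!\<close> is the generalised binomial coefficient
  \<open>\<mu> gchoose s\<close>.
\<close>

definition delta_left :: "real \<Rightarrow> real \<Rightarrow> (nat \<Rightarrow> complex) \<Rightarrow> nat \<Rightarrow> complex" where
  "delta_left \<mu> h x t =
     complex_of_real (1 / h powr \<mu>) *
       (\<Sum>s=0..t. complex_of_real ((-1) ^ s * (\<mu> gchoose s)) * x (t - s))"

definition delta_right :: "real \<Rightarrow> real \<Rightarrow> nat \<Rightarrow> (nat \<Rightarrow> complex) \<Rightarrow> nat \<Rightarrow> complex" where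
  "delta_right \<mu> h n x t =
     complex_of_real (1 / h powr \<mu>) *
       (\<Sum>s=0..n - t. complex_of_real ((-1) ^ s * (\<mu> gchoose s)) * x (t + s))"

definition fractional_SL_solution ::
  "real \<Rightarrow> real \<Rightarrow> nat \<Rightarrow> (nat \<Rightarrow> real) \<Rightarrow> (nat \<Rightarrow> real) \<Rightarrow> (nat \<Rightarrow> real) \<Rightarrow>
     complex \<Rightarrow> (nat \<Rightarrow> complex) \<Rightarrow> bool" where
  "fractional_SL_solution \<mu> h n p q r lam x \<longleftrightarrow>
     (\<forall>t\<in>{0..n}.
        delta_left \<mu> h (\<lambda>u. complex_of_real (p u) * delta_right \<mu> h n x u) t
          + complex_of_real (q t) * x t
        = lam * complex_of_real (r t) * x t)"

definition fractional_SL_eigenvalue ::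
  "real \<Rightarrow> real \<Rightarrow> nat \<Rightarrow> (nat \<Rightarrow> real) \<Rightarrow> (nat \<Rightarrow> real) \<Rightarrow> (nat \<Rightarrow> real) \<Rightarrow>
     complex \<Rightarrow> bool" where
  "fractional_SL_eigenvalue \<mu> h n p q r lam \<longleftrightarrow>
     (\<exists>x. fractional_SL_solution \<mu> h n p q r lam x \<and> (\<exists>t\<in>{0..n}. x t \<noteq> 0))"

end

theory Submission
  imports Defs
begin

text \<open>
  The right difference is the transpose of the left difference for the bilinear form
  \<open>\<Sum>t\<le>n. f t * g t\<close>. Multiplying the equation by the conjugate of \<open>x\<close> and summing over \<open>J\<close>
  therefore gives \<open>\<Sum> p |\<Delta>\<^sub>+ x|^2 + \<Sum> q |x|^2 = \<lambda> \<Sum> r |x|^2\<close>, with a positive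
  factor of \<open>\<lambda>\<close>.
\<close>

lemma delta_left_right_adjoint:
  "(\<Sum>t=0..n. delta_left \<mu> h f t * g t) = (\<Sum>t=0..n. f t * delta_right \<mu> h n g t)"
proof -
  define c where "c s = complex_of_real ((-1) ^ s * (\<mu> gchoose s))" for s
  have "(\<Sum>t=0..n. \<Sum>s=0..t. c s * f (t - s) * g t)
      = (\<Sum>(t, s)\<in>(SIGMA t:{0..n}. {0..t}). c s * f (t - s) * g t)"
    by (simp add: sum.Sigma)
  \<comment> \<open>The substitution \<open>u = t - s\<close> maps the triangle
    \<open>s \<le> t \<le> n\<close> onto \<open>u + s \<le> n\<close>; since
    \<open>s \<le> t\<close>, the subtraction on naturals never truncates.\<close>
  also have "\<dots> = (\<Sum>(u, s)\<in>(SIGMA u:{0..n}. {0..n - u}). f u * (c s * g (u + s)))"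
    by (rule sum.reindex_bij_witness
          [where i = "\<lambda>(u, s). (u + s, s)" and j = "\<lambda>(t, s). (t - s, s)"]) auto
  also have "\<dots> = (\<Sum>u=0..n. \<Sum>s=0..n - u. f u * (c s * g (u + s)))"
    by (simp add: sum.Sigma)
  finally have "complex_of_real (1 / h powr \<mu>) * (\<Sum>t=0..n. \<Sum>s=0..t. c s * f (t - s) * g t)
      = complex_of_real (1 / h powr \<mu>) * (\<Sum>u=0..n. \<Sum>s=0..n - u. f u * (c s * g (u + s)))"
    by (rule arg_cong)
  then show ?thesis
    unfolding delta_left_def delta_right_def c_def
    by (simp only: sum_distrib_left sum_distrib_right mult_ac)
qed

text \<open>The coefficients and the factor \<open>1 / h powr \<mu>\<close> are real, so conjugation
  passes through the sum.\<close>

lemma delta_right_cnj: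
  "delta_right \<mu> h n (\<lambda>t. cnj (x t)) t = cnj (delta_right \<mu> h n x t)"
  by (simp add: delta_right_def)

theorem theorem14:
  fixes \<mu> h :: real and n :: nat
    and p q r :: "nat \<Rightarrow> real" and lam :: complex
  assumes "0 < \<mu>" and "\<mu> \<le> 1" and "h > 0" and "n \<ge> 1"
    and "\<And>t. t \<in> {0..n} \<Longrightarrow> p t > 0"
    and "\<And>t. t \<in> {0..n} \<Longrightarrow> r t > 0"
    and "fractional_SL_eigenvalue \<mu> h n p q r lam"
  shows "lam \<in> \<real>"
proof -
  obtain x where sol: "fractional_SL_solution \<mu> h n p q r lam x"
    and nz: "\<exists>t\<in>{0..n}. x t \<noteq> 0"
    using assms(7) unfolding fractional_SL_eigenvalue_def by blast
  define y where "y = delta_right \<mu> h n x"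
  define R where "R = (\<Sum>t=0..n. r t * (cmod (x t))\<^sup>2)"
  define A where "A = (\<Sum>t=0..n. p t * (cmod (y t))\<^sup>2) + (\<Sum>t=0..n. q t * (cmod (x t))\<^sup>2)"
  \<comment> \<open>One nonzero value of \<open>x\<close> on \<open>J\<close> gives a strictly
    positive summand, the others being nonnegative.\<close>
  have "R > 0"
    unfolding R_def using nz assms(6)
    by (auto intro!: sum_pos2 simp: less_imp_le)
  have "complex_of_real A = (\<Sum>t=0..n. complex_of_real (p t) * y t * cnj (y t))
      + (\<Sum>t=0..n. complex_of_real (q t) * x t * cnj (x t))"
    by (simp add: A_def complex_norm_square mult.assoc del: of_real_power)
  \<comment> \<open>Adjointness with \<open>f = p * y\<close> and \<open>g = cnj x\<close>, where
    \<open>cnj y\<close> is the right difference of \<open>cnj x\<close>.\<close>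
  also have "(\<Sum>t=0..n. complex_of_real (p t) * y t * cnj (y t))
      = (\<Sum>t=0..n. delta_left \<mu> h (\<lambda>u. complex_of_real (p u) * y u) t * cnj (x t))"
    by (simp add: delta_left_right_adjoint delta_right_cnj y_def)
  also have "\<dots> + (\<Sum>t=0..n. complex_of_real (q t) * x t * cnj (x t))
      = (\<Sum>t=0..n. (delta_left \<mu> h (\<lambda>u. complex_of_real (p u) * y u) t
          + complex_of_real (q t) * x t) * cnj (x t))"
    by (simp add: sum.distrib distrib_right)
  also have "\<dots> = (\<Sum>t=0..n. lam * complex_of_real (r t) * x t * cnj (x t))"
    using sol unfolding fractional_SL_solution_def y_def by (intro sum.cong) auto
  also have "\<dots> = lam * complex_of_real R"
    by (simp add: R_def complex_norm_square mult.assoc sum_distrib_left del: of_real_power)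
  \<comment> \<open>The chain reads \<open>A = lam * R\<close> with \<open>A\<close> and
    \<open>R\<close> real; the sign of \<open>A\<close>, hence of \<open>q\<close>, is
    irrelevant.\<close>
  finally have "lam = complex_of_real (A / R)"
    using \<open>R > 0\<close> by (simp add: field_simps)
  then show ?thesis
    by simp
qed

end
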